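(* Let $(X,Y,\tilde Y)$ take values in $\mathcal{X}\times\{0,1\}\times\{0,1\}$, with regression function $\eta$, label noise functions $\rho_0,\rho_1$, Bayes classifier $C^{\mathrm{Bayes}}$, corrupted Bayes classifier $\tilde C^{\mathrm{Bayes}}$, risk $R$ and corrupted risk $\tilde R$ as defined in the context. Let $\mathcal{S}=\{x\in\mathcal{X}:\eta(x)=1/2\}$, $\mathcal{B}=\{x\in\mathcal{S}^c:\rho_0(x)+\rho_1(x)<1\}$ and \[ \mathcal{A}=\biggl\{x\in\mathcal{B}:\frac{\rho_1(x)-\rho_0(x)}{\{2\eta(x)-1\}\{1-\rho_0(x)-\rho_1(x)\}}<1\biggr\}. \] (i) We have \[ P_X\bigl(\mathcal{A}\,\triangle\,\{x\in\mathcal{B}:\tilde C^{\mathrm{Bayes}}(x)=C^{\mathrm{Bayes}}(x)\}\bigr)=0 . \] In particular, if $P_X(\mathcal{A}^c\cap\mathcal{S}^c)=0$, then $P_X\bigl(\{x\in\mathcal{S}^c:\tilde C^{\mathrm{Bayes}}(x)\neq C^{\mathrm{Bayes}}(x)\}\bigr)=0$. (ii) Suppose, in fact, that there exist $\rho^*<1/2$ and $a^*<1$ such that $P_X(\{x\in\mathcal{S}^c:\rho_0(x)+\rho_1(x)>2\rho^*\})=0$ and \[ P_X\biggl(\biggl\{x\in\mathcal{B}:\frac{\rho_1(x)-\rho_0(x)}{\{2\eta(x)-1\}\{1-\rho_0(x)-\rho_1(x)\}}>a^*\biggr\}\biggr)=0 . \] Then, for any classifier $C$, \[ R(C)-R(C^{\mathrm{Bayes}})\leq\frac{\tilde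 R(C)-\tilde R(\tilde C^{\mathrm{Bayes}})}{(1-2\rho^* )(1-a^* )} . \]
   Context: $\mathcal{X}$ is a measurable space and $(X,Y,\tilde Y)$ is a random triple in $\mathcal{X}\times\{0,1\}\times\{0,1\}$, where $X$ is a feature vector, $Y$ the true label and $\tilde Y$ a noisy label; $\mathbb{P}(Y=1)\in(0,1)$. $P_X$ is the distribution of $X$. The regression function is $\eta(x)=\mathbb{P}(Y=1\mid X=x)$. The measurable functions $\rho_0,\rho_1:\mathcal{X}\to[0,1]$ are given by $\rho_r(x)=\mathbb{P}(\tilde Y\neq Y\mid X=x,Y=r)$. The corrupted regression function is $\tilde\eta(x)=\mathbb{P}(\tilde Y=1\mid X=x)=\eta(x)\{1-\rho_1(x)\}+\{1-\eta(x)\}\rho_0(x)$. $C^{\mathrm{Bayes}}(x)=1$ if $\eta(x)\ge1/2$ and $0$ otherwise; $\tilde C^{\mathrm{Bayes}}(x)=1$ if $\tilde\eta(x)\ge1/2$ and $0$ otherwise. A classifier $C$ is a measurable function from $\mathcal{X}$ to $\{0,1\}$; it may also depend (jointly measurably) on training data independent of $(X,Y,\tilde Y)$, in which case probabilities below are also over the training data. Its risk is $R(C)=\mathbb{P}\{C(X)\neq Y\}$ and its corrupted risk is $\tilde R(C)=\mathbb{P}\{C(X)\neq\tilde Y\}$. $\triangle$ denotes symmetric difference of sets.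
   Formalization: The first display of (i) fails when points of B with η>1/2 and corrupted regression function exactly 1/2 carry mass (e.g. η=3/4, ρ_0=0, ρ_1=1/3); it is stated under the added assumption that this tie set has P_X-measure zero. *)

theory Defs
  imports "HOL-Probability.Probability"
begin

abbreviation labels :: "nat measure" where
  "labels \<equiv> count_space {0, 1}"

text \<open>\<open>g\<close> is a version of \<open>x \<mapsto> P(E | U = x)\<close>: a measurable \<open>[0,1]\<close>-valued function with
  \<open>P(E | \<sigma>(U)) = g(U)\<close> almost surely.\<close>

definition is_cond_prob ::
  "'w measure \<Rightarrow> 'u measure \<Rightarrow> ('w \<Rightarrow> 'u) \<Rightarrow> 'w set \<Rightarrow> ('u \<Rightarrow> real) \<Rightarrow> bool" where
  "is_cond_prob M N U E g \<longleftrightarrow>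
     g \<in> borel_measurable N \<and> (\<forall>x\<in>space N. 0 \<le> g x \<and> g x \<le> 1) \<and>
     (AE w in M. real_cond_exp M (vimage_algebra (space M) U N) (indicator E) w = g (U w))"

text \<open>\<open>Yt\<close> is the noisy label. The noise functions \<open>\<rho> 0\<close> and \<open>\<rho> 1\<close> are obtained by conditioning
  on the pair \<open>(X, Y)\<close>. The functions \<open>\<eta>\<close> and \<open>\<eta>t\<close> are arbitrary versions of the two regression
  functions; in particular \<open>\<eta>t = \<eta> (1 - \<rho> 1) + (1 - \<eta>) \<rho> 0\<close> holds almost everywhere
  as a consequence, and is not assumed.\<close>

locale label_noise = prob_space M for M :: "'w measure" +
  fixes N :: "'x measure"
    and X :: "'w \<Rightarrow> 'x" and Y Yt :: "'w \<Rightarrow> nat"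
    and \<eta> :: "'x \<Rightarrow> real" and \<rho> :: "nat \<Rightarrow> 'x \<Rightarrow> real" and \<eta>t :: "'x \<Rightarrow> real"
  assumes X: "X \<in> measurable M N"
    and Y: "Y \<in> measurable M labels"
    and Yt: "Yt \<in> measurable M labels"
    and nondegenerate: "0 < measure M {w \<in> space M. Y w = 1}" "measure M {w \<in> space M. Y w = 1} < 1"
    and regression: "is_cond_prob M N X {w \<in> space M. Y w = 1} \<eta>"
    and noise: "is_cond_prob M (N \<Otimes>\<^sub>M labels) (\<lambda>w. (X w, Y w))
                  {w \<in> space M. Yt w \<noteq> Y w} (\<lambda>(x, r). \<rho> r x)"
    and corrupted_regression: "is_cond_prob M N X {w \<in> space M. Yt w = 1} \<eta>t"

text \<open>Applied to \<open>\<eta>\<close> this is the Bayes classifier, applied to \<open>\<eta>t\<close> the corrupted one.\<close>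

definition bayes :: "('x \<Rightarrow> real) \<Rightarrow> 'x \<Rightarrow> nat" where
  "bayes h x = (if h x \<ge> 1 / 2 then 1 else 0)"

text \<open>\<open>U\<close> is the input of the classifier: \<open>X\<close> itself, or \<open>X\<close> paired with the training data.
  The risk is obtained with \<open>L = Y\<close>, the corrupted risk with \<open>L = Yt\<close>.\<close>

definition risk :: "'w measure \<Rightarrow> ('w \<Rightarrow> 'u) \<Rightarrow> ('w \<Rightarrow> nat) \<Rightarrow> ('u \<Rightarrow> nat) \<Rightarrow> real" where
  "risk M U L C = measure M {w \<in> space M. C (U w) \<noteq> L w}"

text \<open>\<open>T\<close> is training data with values in \<open>K\<close>, independent of \<open>(X, Y, Yt)\<close>. The library's
  \<open>indep_var\<close> needs both variables to have the same type, hence the \<open>\<sigma>\<close>-algebras.\<close>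

definition training_data ::
  "'w measure \<Rightarrow> 'x measure \<Rightarrow> ('w \<Rightarrow> 'x) \<Rightarrow> ('w \<Rightarrow> nat) \<Rightarrow> ('w \<Rightarrow> nat) \<Rightarrow>
   't measure \<Rightarrow> ('w \<Rightarrow> 't) \<Rightarrow> bool" where
  "training_data M N X Y Yt K T \<longleftrightarrow>
     T \<in> measurable M K \<and>
     prob_space.indep_set M
       (sets (vimage_algebra (space M) T K))
       (sets (vimage_algebra (space M) (\<lambda>w. (X w, Y w, Yt w)) (N \<Otimes>\<^sub>M labels \<Otimes>\<^sub>M labels)))"

definition noise_ratio :: "('x \<Rightarrow> real) \<Rightarrow> (nat \<Rightarrow> 'x \<Rightarrow> real) \<Rightarrow> 'x \<Rightarrow> real" where
  "noise_ratio \<eta> \<rho> x = (\<rho> 1 x - \<rho> 0 x) / ((2 * \<eta> x - 1) * (1 - \<rho> 0 x - \<rho> 1 x))"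

definition setS :: "'x measure \<Rightarrow> ('x \<Rightarrow> real) \<Rightarrow> 'x set" where
  "setS N \<eta> = {x \<in> space N. \<eta> x = 1 / 2}"

definition setB :: "'x measure \<Rightarrow> ('x \<Rightarrow> real) \<Rightarrow> (nat \<Rightarrow> 'x \<Rightarrow> real) \<Rightarrow> 'x set" where
  "setB N \<eta> \<rho> = {x \<in> space N - setS N \<eta>. \<rho> 0 x + \<rho> 1 x < 1}"

definition setA :: "'x measure \<Rightarrow> ('x \<Rightarrow> real) \<Rightarrow> (nat \<Rightarrow> 'x \<Rightarrow> real) \<Rightarrow> 'x set" where
  "setA N \<eta> \<rho> = {x \<in> setB N \<eta> \<rho>. noise_ratio \<eta> \<rho> x < 1}"

end

theory Submission
  imports Defs
begin

text \<open>On \<open>B\<close> the corrupted regression function satisfies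
  \<open>2 \<eta>t - 1 = (2 \<eta> - 1) (1 - \<rho> 0 - \<rho> 1) (1 - noise_ratio)\<close> almost everywhere, so, up to ties
  \<open>\<eta>t = 1/2\<close>, the two Bayes classifiers agree exactly where the last factor is positive. Under the
  assumptions of part (ii), off \<open>S\<close> the two classifiers agree and
  \<open>\<bar>2 \<eta>t - 1\<bar> \<ge> \<bar>2 \<eta> - 1\<bar> (1 - 2 \<rho>s) (1 - as)\<close> almost everywhere, and the excess risks are the integrals of
  \<open>\<bar>2 \<eta> - 1\<bar>\<close> and \<open>\<bar>2 \<eta>t - 1\<bar>\<close> over the set on which \<open>C\<close> differs from the respective Bayes
  classifier. A classifier depending on training data is treated by conditioning on the data.\<close>

section \<open>Null sets and measurability\<close>

lemma measure_eq_0_AE: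
  assumes "AE x in M. x \<notin> A"
  shows "measure M A = 0"
proof (cases "A \<in> sets M")
  case True
  have "{x \<in> space M. \<not> x \<notin> A} = A"
    using sets.sets_into_space[OF True] by auto
  then have "A \<in> null_sets M"
    using assms True AE_iff_null[of M "\<lambda>x. x \<notin> A"] by simp
  then show ?thesis
    by (simp add: measure_def null_setsD1)
next
  \<comment> \<open>Outside \<open>sets M\<close> the default value of \<open>measure\<close> is
    0.\<close>
  case False
  then show ?thesis by (rule measure_notin_sets)
qed

lemma measurable_labels_UNIV:
  assumes "C \<in> measurable N labels"
  shows "C \<in> measurable N (count_space UNIV)"
  by (rule measurable_compose[OF assms]) simp

lemma measurable_neq_nat:
  fixes f g :: "'a \<Rightarrow> nat"
  assumes [measurable]: "f \<in> measurable N (count_space UNIV)" "g \<in> measurable N (count_space UNIV)"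
  shows "Measurable.pred N (\<lambda>x. f x \<noteq> g x)"
proof -
  have "(\<lambda>x. real (f x)) \<in> borel_measurable N" "(\<lambda>x. real (g x)) \<in> borel_measurable N"
    by measurable
  from borel_measurable_neq[OF this] show ?thesis
    by (simp add: pred_def)
qed

lemma (in finite_measure) integrable_bounded:
  fixes g :: "'a \<Rightarrow> real"
  assumes "g \<in> borel_measurable M" "\<And>w. w \<in> space M \<Longrightarrow> \<bar>g w\<bar> \<le> c"
  shows "integrable M g"
  using assms by (intro integrable_const_bound[where B = c]) auto

section \<open>Conditional probabilities and independence\<close>

lemma subalgebra_vimage_algebra:
  assumes "U \<in> measurable M N"
  shows "subalgebra M (vimage_algebra (space M) U N)"
  unfolding subalgebra_def
  using assms measurable_space[OF assms] measurable_sets[OF assms]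
  by (auto simp: sets_vimage_algebra2)

text \<open>Since \<open>f (U w)\<close> is measurable for the \<sigma>-algebra generated by
  \<open>U\<close>, it can be moved inside the conditional expectation of the indicator. The almost
  sure identity in \<open>is_cond_prob\<close> is only ever used in this test-function form; the
  bound on \<open>f\<close> provides integrability.\<close>

lemma (in prob_space) cond_prob_integral:
  fixes f :: "'u \<Rightarrow> real"
  assumes U [measurable]: "U \<in> measurable M N" and E [measurable]: "E \<in> events"
    and g: "is_cond_prob M N U E g"
    and f [measurable]: "f \<in> borel_measurable N"
    and bound: "\<And>x. x \<in> space N \<Longrightarrow> \<bar>f x\<bar> \<le> c"
  shows "(\<integral>w. f (U w) * indicator E w \<partial>M) = (\<integral>w. f (U w) * g (U w) \<partial>M)"
proof -
  let ?F = "vimage_algebra (space M) U N"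
  interpret F: finite_measure_subalgebra M ?F
    by unfold_locales (rule subalgebra_vimage_algebra[OF U])
  have [measurable]: "g \<in> borel_measurable N"
    and ae: "AE w in M. real_cond_exp M ?F (indicator E) w = g (U w)"
    using g by (auto simp: is_cond_prob_def)
  have fU: "(\<lambda>w. f (U w)) \<in> borel_measurable ?F"
    using measurable_comp[OF measurable_vimage_algebra1 f, of U "space M"] measurable_space[OF U]
    by (auto simp: comp_def)
  have "integrable M (\<lambda>w. f (U w) * indicator E w :: real)"
  proof (rule integrable_const_bound[where B = "c"])
    show "AE w in M. norm (f (U w) * indicator E w) \<le> c"
    proof (rule AE_I2)
      fix w assume "w \<in> space M"
      then have "\<bar>f (U w)\<bar> \<le> c"
        using bound measurable_space[OF U] by auto
      then show "norm (f (U w) * indicator E w) \<le> c"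
        by (auto simp: indicator_def)
    qed
  qed measurable
  then have "(\<integral>w. f (U w) * indicator E w \<partial>M)
      = (\<integral>w. f (U w) * real_cond_exp M ?F (indicator E) w \<partial>M)"
    by (rule F.real_cond_exp_intg(2)[OF _ fU, symmetric]) measurable
  also have "\<dots> = (\<integral>w. f (U w) * g (U w) \<partial>M)"
    using ae by (intro integral_cong_AE) (auto simp: borel_measurable_cond_exp2)
  finally show ?thesis .
qed

text \<open>Fubini for the law of \<open>(T, Z)\<close>: independence makes it the product of the
  marginals, so \<open>T\<close> can be frozen at \<open>t\<close> and averaged out
  afterwards.\<close>

lemma (in prob_space) indep_prob_integral:
  assumes T [measurable]: "T \<in> measurable M K" and Z [measurable]: "Z \<in> measurable M Q"
    and indep: "indep_set (sets (vimage_algebra (space M) T K)) (sets (vimage_algebra (space M) Z Q))"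
    and P [measurable]: "Measurable.pred (K \<Otimes>\<^sub>M Q) P"
  shows "integrable (distr M K T) (\<lambda>t. prob {w \<in> space M. P (t, Z w)})"
    and "prob {w \<in> space M. P (T w, Z w)} = (\<integral>t. prob {w \<in> space M. P (t, Z w)} \<partial>distr M K T)"
proof -
  interpret D: prob_space "distr M K T" by (rule prob_space_distr) fact
  interpret E: prob_space "distr M Q Z" by (rule prob_space_distr) fact
  interpret DE: pair_prob_space "distr M K T" "distr M Q Z" ..
  have joint: "distr M K T \<Otimes>\<^sub>M distr M Q Z = distr M (K \<Otimes>\<^sub>M Q) (\<lambda>w. (T w, Z w))"
  proof (rule pair_measure_eqI)
    fix a b assume "a \<in> sets (distr M K T)" "b \<in> sets (distr M Q Z)"
    then have [measurable]: "a \<in> sets K" "b \<in> sets Q" by auto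
    \<comment> \<open>Independence on rectangles is enough to identify the product measure.\<close>
    have "prob ((T -` a \<inter> space M) \<inter> (Z -` b \<inter> space M))
        = prob (T -` a \<inter> space M) * prob (Z -` b \<inter> space M)"
      by (rule indep_setD[OF indep]) (auto intro!: in_vimage_algebra)
    moreover have "(\<lambda>w. (T w, Z w)) -` (a \<times> b) \<inter> space M
        = (T -` a \<inter> space M) \<inter> (Z -` b \<inter> space M)"
      by auto
    ultimately show "emeasure (distr M K T) a * emeasure (distr M Q Z) b
        = emeasure (distr M (K \<Otimes>\<^sub>M Q) (\<lambda>w. (T w, Z w))) (a \<times> b)"
      by (simp add: emeasure_distr emeasure_eq_measure ennreal_mult)
  qed (auto intro: D.sigma_finite_measure E.sigma_finite_measure)
  let ?f = "\<lambda>z. indicator {z. P z} z :: real"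
  have [measurable]: "?f \<in> borel_measurable (K \<Otimes>\<^sub>M Q)"
    by measurable
  have int: "integrable (distr M K T \<Otimes>\<^sub>M distr M Q Z) ?f"
    by (rule DE.integrable_const_bound[where B = 1]) (auto simp: indicator_def)
  have inner: "(\<integral>z. ?f (t, z) \<partial>distr M Q Z) = prob {w \<in> space M. P (t, Z w)}"
    if "t \<in> space K" for t
  proof -
    have [measurable]: "(\<lambda>z. ?f (t, z)) \<in> borel_measurable Q" "Measurable.pred Q (\<lambda>z. P (t, z))"
      using that by measurable
    have "(\<integral>z. ?f (t, z) \<partial>distr M Q Z) = (\<integral>w. ?f (t, Z w) \<partial>M)"
      by (rule integral_distr) measurable
    also have "\<dots> = (\<integral>w. indicator {w \<in> space M. P (t, Z w)} w \<partial>M)"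
      by (rule Bochner_Integration.integral_cong) (auto simp: indicator_def)
    also have "\<dots> = prob {w \<in> space M. P (t, Z w)}"
      by (simp add: Int_def conj_commute)
    finally show ?thesis .
  qed
  show "integrable (distr M K T) (\<lambda>t. prob {w \<in> space M. P (t, Z w)})"
    using DE.integrable_fst'[OF int] inner
    by (subst Bochner_Integration.integrable_cong[OF refl, of _ _ "\<lambda>t. \<integral>z. ?f (t, z) \<partial>distr M Q Z"]) auto
  have "prob {w \<in> space M. P (T w, Z w)} = (\<integral>w. indicator {w \<in> space M. P (T w, Z w)} w \<partial>M)"
    by (simp add: Int_def conj_commute)
  also have "\<dots> = (\<integral>w. ?f (T w, Z w) \<partial>M)"
    by (rule Bochner_Integration.integral_cong) (auto simp: indicator_def)
  also have "\<dots> = (\<integral>z. ?f z \<partial>distr M (K \<Otimes>\<^sub>M Q) (\<lambda>w. (T w, Z w)))"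
    by (rule integral_distr[symmetric]) measurable
  also have "\<dots> = (\<integral>t. (\<integral>z. ?f (t, z) \<partial>distr M Q Z) \<partial>distr M K T)"
    using DE.integral_fst'[OF int] joint by simp
  also have "\<dots> = (\<integral>t. prob {w \<in> space M. P (t, Z w)} \<partial>distr M K T)"
    by (rule Bochner_Integration.integral_cong) (auto simp: inner)
  finally show "prob {w \<in> space M. P (T w, Z w)} = (\<integral>t. prob {w \<in> space M. P (t, Z w)} \<partial>distr M K T)" .
qed

section \<open>Risks and excess risks as integrals\<close>

text \<open>For 0-1 labels, \<open>1{C \<noteq> L} = C + (1 - 2 C) 1{L = 1}\<close>. This is affine
  in \<open>1{L = 1}\<close> with coefficients depending on \<open>X\<close> alone, so
  \<open>h (X w)\<close> can replace that indicator under the integral.\<close>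

lemma (in prob_space) risk_eq_integral:
  assumes X [measurable]: "X \<in> measurable M N" and L [measurable]: "L \<in> measurable M labels"
    and h: "is_cond_prob M N X {w \<in> space M. L w = 1} h"
    and C [measurable]: "C \<in> measurable N labels"
  shows "risk M X L C = (\<integral>w. real (C (X w)) + (1 - 2 * real (C (X w))) * h (X w) \<partial>M)"
proof -
  have C01: "C (X w) = 0 \<or> C (X w) = 1" and L01: "L w = 0 \<or> L w = 1" if "w \<in> space M" for w
    using measurable_space[OF C] measurable_space[OF L that] measurable_space[OF X that] by auto
  have [measurable]: "h \<in> borel_measurable N" and h01: "\<And>x. x \<in> space N \<Longrightarrow> 0 \<le> h x \<and> h x \<le> 1"
    using h by (auto simp: is_cond_prob_def)
  let ?E = "{w \<in> space M. L w = 1}"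
  have [measurable]: "C \<in> measurable N (count_space UNIV)" "L \<in> measurable M (count_space UNIV)"
    using C L by (simp_all add: measurable_labels_UNIV)
  have hX: "0 \<le> h (X w) \<and> h (X w) \<le> 1" if "w \<in> space M" for w
    using h01 measurable_space[OF X that] by auto
  have i1: "integrable M (\<lambda>w. real (C (X w)))"
    using C01 by (intro integrable_const_bound[where B = 1] AE_I2) fastforce+
  have i2: "integrable M (\<lambda>w. (1 - 2 * real (C (X w))) * indicator ?E w :: real)"
  proof (intro integrable_const_bound[where B = 1] AE_I2)
    fix w assume "w \<in> space M"
    then show "norm ((1 - 2 * real (C (X w))) * indicator ?E w :: real) \<le> 1"
      using C01[of w] by (auto simp: indicator_def)
  qed measurable
  have i3: "integrable M (\<lambda>w. (1 - 2 * real (C (X w))) * h (X w))"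
  proof (intro integrable_const_bound[where B = 1] AE_I2)
    fix w assume "w \<in> space M"
    then show "norm ((1 - 2 * real (C (X w))) * h (X w)) \<le> 1"
      using C01[of w] hX[of w] by auto
  qed measurable
  have "risk M X L C = (\<integral>w. indicator {w \<in> space M. C (X w) \<noteq> L w} w \<partial>M)"
    by (simp add: risk_def Int_def conj_commute)
  also have "\<dots> = (\<integral>w. real (C (X w)) + (1 - 2 * real (C (X w))) * indicator ?E w \<partial>M)"
  proof (rule Bochner_Integration.integral_cong[OF refl])
    fix w assume "w \<in> space M"
    then show "indicator {w \<in> space M. C (X w) \<noteq> L w} w
        = real (C (X w)) + (1 - 2 * real (C (X w))) * indicator ?E w"
      using C01[of w] L01[of w] by (auto simp: indicator_def)
  qed
  also have "\<dots> = (\<integral>w. real (C (X w)) \<partial>M) + (\<integral>w. (1 - 2 * real (C (X w))) * indicator ?E w \<partial>M)"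
    by (rule Bochner_Integration.integral_add[OF i1 i2])
  also have "(\<integral>w. (1 - 2 * real (C (X w))) * indicator ?E w \<partial>M)
      = (\<integral>w. (1 - 2 * real (C (X w))) * h (X w) \<partial>M)"
  proof (rule cond_prob_integral[OF X _ h, where f = "\<lambda>x. 1 - 2 * real (C x)"])
    show "\<bar>1 - 2 * real (C x)\<bar> \<le> 1" if "x \<in> space N" for x
      using measurable_space[OF C that] by auto
  qed measurable
  also have "(\<integral>w. real (C (X w)) \<partial>M) + \<dots>
      = (\<integral>w. real (C (X w)) + (1 - 2 * real (C (X w))) * h (X w) \<partial>M)"
    by (rule Bochner_Integration.integral_add[OF i1 i3, symmetric])
  finally show ?thesis .
qed

lemma measurable_bayes [measurable]:
  assumes [measurable]: "h \<in> borel_measurable N"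
  shows "bayes h \<in> measurable N labels"
proof -
  have "(\<lambda>x. if 1 / 2 \<le> h x then 1 else 0 :: nat) \<in> measurable N labels"
    by (rule measurable_If) auto
  then show ?thesis by (simp add: bayes_def[abs_def])
qed

text \<open>The integrand is \<open>\<bar>2 h - 1\<bar>\<close> where \<open>C\<close> and
  \<open>bayes h\<close> differ and 0 elsewhere, because \<open>bayes h\<close> is 1 exactly when
  \<open>2 h - 1 \<ge> 0\<close>. The product form is the plain difference of the two integrands
  from \<open>risk_eq_integral\<close>.\<close>

lemma (in prob_space) excess_risk_integral:
  assumes X [measurable]: "X \<in> measurable M N" and L: "L \<in> measurable M labels"
    and h: "is_cond_prob M N X {w \<in> space M. L w = 1} h"
    and C [measurable]: "C \<in> measurable N labels"
  shows "integrable M (\<lambda>w. (2 * h (X w) - 1) * (real (bayes h (X w)) - real (C (X w))))"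
    and "risk M X L C - risk M X L (bayes h)
      = (\<integral>w. (2 * h (X w) - 1) * (real (bayes h (X w)) - real (C (X w))) \<partial>M)"
proof -
  have hm [measurable]: "h \<in> borel_measurable N" and h01: "\<And>x. x \<in> space N \<Longrightarrow> 0 \<le> h x \<and> h x \<le> 1"
    using h by (auto simp: is_cond_prob_def)
  have int: "integrable M (\<lambda>w. real (c (X w)) + (1 - 2 * real (c (X w))) * h (X w))"
    if c: "c \<in> measurable N labels" for c
  proof -
    have [measurable]: "c \<in> measurable N (count_space UNIV)"
      using c by (rule measurable_labels_UNIV)
    \<comment> \<open>The integrand is \<open>h\<close> where \<open>c\<close> is 0 and
      \<open>1 - h\<close> where \<open>c\<close> is 1; the bound 2 is generous.\<close>
    show ?thesis
    proof (intro integrable_const_bound[where B = 2] AE_I2)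
      fix w assume "w \<in> space M"
      then have "X w \<in> space N" using measurable_space[OF X] by auto
      then show "norm (real (c (X w)) + (1 - 2 * real (c (X w))) * h (X w)) \<le> 2"
        using h01[of "X w"] measurable_space[OF c, of "X w"] by auto
    qed measurable
  qed
  have eq: "(2 * h (X w) - 1) * (real (bayes h (X w)) - real (C (X w)))
     = (real (C (X w)) + (1 - 2 * real (C (X w))) * h (X w))
        - (real (bayes h (X w)) + (1 - 2 * real (bayes h (X w))) * h (X w))" for w
    by (simp add: algebra_simps)
  show "integrable M (\<lambda>w. (2 * h (X w) - 1) * (real (bayes h (X w)) - real (C (X w))))"
    unfolding eq by (intro Bochner_Integration.integrable_diff int) measurable
  show "risk M X L C - risk M X L (bayes h)
      = (\<integral>w. (2 * h (X w) - 1) * (real (bayes h (X w)) - real (C (X w))) \<partial>M)"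
    unfolding eq risk_eq_integral[OF X L h C] risk_eq_integral[OF X L h measurable_bayes[OF hm]]
    by (intro Bochner_Integration.integral_diff[symmetric] int) measurable
qed

section \<open>The corrupted regression function\<close>

context label_noise
begin

text \<open>Each \<open>\<rho> r\<close> is the section at a label \<open>r\<close> of the jointly
  measurable function in \<open>noise\<close>. The label 1 also appears in its normal form
  \<open>Suc 0\<close>.\<close>

lemma measurable_assms [measurable]:
  "X \<in> measurable M N" "Y \<in> measurable M labels" "Yt \<in> measurable M labels"
  "\<eta> \<in> borel_measurable N" "\<eta>t \<in> borel_measurable N"
  "\<rho> 0 \<in> borel_measurable N" "\<rho> 1 \<in> borel_measurable N" "\<rho> (Suc 0) \<in> borel_measurable N"
proof -
  have n: "(\<lambda>(x, r). \<rho> r x) \<in> borel_measurable (N \<Otimes>\<^sub>M labels)"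
    using noise by (simp add: is_cond_prob_def)
  have r: "\<rho> r \<in> borel_measurable N" if "r \<in> {0, 1}" for r
    using measurable_comp[OF _ n, of "\<lambda>x. (x, r)" N] that by (simp add: comp_def)
  show "\<rho> 0 \<in> borel_measurable N" "\<rho> 1 \<in> borel_measurable N" "\<rho> (Suc 0) \<in> borel_measurable N"
    using r by auto
qed (use X Y Yt regression corrupted_regression in \<open>auto simp: is_cond_prob_def\<close>)

lemma unit_interval:
  assumes "x \<in> space N"
  shows "0 \<le> \<eta> x" "\<eta> x \<le> 1" "0 \<le> \<eta>t x" "\<eta>t x \<le> 1"
    "0 \<le> \<rho> 0 x" "\<rho> 0 x \<le> 1" "0 \<le> \<rho> 1 x" "\<rho> 1 x \<le> 1"
  using assms regression corrupted_regression noise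
  by (auto simp: is_cond_prob_def space_pair_measure)

lemma corrupted_regression_eq:
  "AE w in M. \<eta>t (X w) = \<eta> (X w) * (1 - \<rho> 1 (X w)) + (1 - \<eta> (X w)) * \<rho> 0 (X w)"
proof -
  define h where "h x = \<eta> x * (1 - \<rho> 1 x) + (1 - \<eta> x) * \<rho> 0 x" for x
  \<comment> \<open>Testing against the difference \<open>f\<close> of the two sides gives \<open>E f(X)\<^sup>2 = 0\<close>. The noise enters via
    \<open>1{Yt = 1} = 1{Y = 1} + (1 - 2 Y) 1{Yt \<noteq> Y}\<close>.\<close>
  define f where "f x = \<eta>t x - h x" for x
  let ?Y1 = "{w \<in> space M. Y w = 1}" and ?E = "{w \<in> space M. Yt w \<noteq> Y w}"
  have [measurable]: "h \<in> borel_measurable N" "f \<in> borel_measurable N"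
    unfolding h_def[abs_def] f_def[abs_def] by measurable
  have h01: "0 \<le> h x \<and> h x \<le> 1" if "x \<in> space N" for x
  proof -
    have "\<eta> x * (1 - \<rho> 1 x) \<le> \<eta> x" "(1 - \<eta> x) * \<rho> 0 x \<le> 1 - \<eta> x"
      using unit_interval[OF that] by (auto intro: mult_left_le)
    then show ?thesis
      using unit_interval[OF that] by (auto simp: h_def)
  qed
  have f1: "\<bar>f x\<bar> \<le> 1" if "x \<in> space N" for x
    using h01[OF that] unit_interval[OF that] by (auto simp: f_def)
  have XN: "X w \<in> space N" if "w \<in> space M" for w
    using measurable_space[OF X that] .
  have Y01: "Y w = 0 \<or> Y w = 1" and Yt01: "Yt w = 0 \<or> Yt w = 1" if "w \<in> space M" for w
    using measurable_space[OF Y that] measurable_space[OF Yt that] by auto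
  \<comment> \<open>The weight of the noise event is a function of the pair \<open>(X, Y)\<close>,
    hence an admissible test function for \<open>noise\<close>.\<close>
  define s where "s = (\<lambda>(x, r :: nat). f x * (1 - 2 * real r))"
  have [measurable]: "snd \<in> measurable (N \<Otimes>\<^sub>M labels) (count_space UNIV)"
    by (rule measurable_labels_UNIV[OF measurable_snd])
  have s_m [measurable]: "s \<in> borel_measurable (N \<Otimes>\<^sub>M labels)"
    unfolding s_def split_beta by measurable
  have s1: "\<bar>s z\<bar> \<le> 1" if "z \<in> space (N \<Otimes>\<^sub>M labels)" for z
    using that f1 by (auto simp: s_def space_pair_measure abs_mult)
  \<comment> \<open>Conditioning on \<open>(X, Y)\<close> produces \<open>f \<rho> 0\<close> where
    \<open>Y\<close> is 0 and \<open>- f \<rho> 1\<close> where \<open>Y\<close> is 1, that is,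
    \<open>f \<rho> 0 + d 1{Y = 1}\<close>. In this form \<open>regression\<close> applies
    again.\<close>
  define d where "d x = f x * (- \<rho> 1 x - \<rho> 0 x)" for x
  have d_m [measurable]: "d \<in> borel_measurable N"
    unfolding d_def[abs_def] by measurable
  have d2: "\<bar>d x\<bar> \<le> 2" if "x \<in> space N" for x
  proof -
    have "\<bar>f x\<bar> * \<bar>- \<rho> 1 x - \<rho> 0 x\<bar> \<le> 1 * 2"
      using f1[OF that] unit_interval[OF that] by (intro mult_mono) auto
    then show ?thesis by (simp add: d_def abs_mult)
  qed
  note bounds = f1 d2 h01 XN unit_interval indicator_le_1
  \<comment> \<open>Every integrand below is a bounded factor times a factor with values in
    [0,1].\<close>
  have prd: "\<bar>a * b :: real\<bar> \<le> c" if "\<bar>a\<bar> \<le> c" "0 \<le> b" "b \<le> 1" for a b c :: real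
  proof -
    have "\<bar>a\<bar> * b \<le> \<bar>a\<bar> * 1" using that by (intro mult_left_mono) auto
    then show ?thesis using that by (simp add: abs_mult)
  qed
  have [measurable]: "?E \<in> events"
    using measurable_neq_nat[OF Yt[THEN measurable_labels_UNIV] Y[THEN measurable_labels_UNIV]]
    by (simp add: pred_def)
  have iY: "integrable M (\<lambda>w. f (X w) * indicator ?Y1 w)"
    by (rule integrable_bounded[where c = 1], measurable, rule prd)
      (auto simp: bounds)
  have isE: "integrable M (\<lambda>w. s (X w, Y w) * indicator ?E w)"
  proof (rule integrable_bounded[where c = 1])
    fix w assume w: "w \<in> space M"
    have "\<bar>s (X w, Y w)\<bar> \<le> 1"
      using w XN Y01[OF w] by (intro s1) (auto simp: space_pair_measure)
    then show "\<bar>s (X w, Y w) * indicator ?E w\<bar> \<le> 1"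
      by (rule prd) (auto simp: indicator_def)
  qed measurable
  have idY: "integrable M (\<lambda>w. d (X w) * indicator ?Y1 w)"
    by (rule integrable_bounded[where c = 2], measurable, rule prd)
      (auto simp: bounds)
  have ir: "integrable M (\<lambda>w. f (X w) * \<rho> 0 (X w))"
    by (rule integrable_bounded[where c = 1], measurable, rule prd)
      (auto simp: bounds)
  have if\<eta>: "integrable M (\<lambda>w. f (X w) * \<eta> (X w))"
    by (rule integrable_bounded[where c = 1], measurable, rule prd)
      (auto simp: bounds)
  have id\<eta>: "integrable M (\<lambda>w. d (X w) * \<eta> (X w))"
    by (rule integrable_bounded[where c = 2], measurable, rule prd)
      (auto simp: bounds)
  have if\<eta>t: "integrable M (\<lambda>w. f (X w) * \<eta>t (X w))"
    by (rule integrable_bounded[where c = 1], measurable, rule prd)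
      (auto simp: bounds)
  have ifh: "integrable M (\<lambda>w. f (X w) * h (X w))"
    by (rule integrable_bounded[where c = 1], measurable, rule prd)
      (auto simp: bounds)
  have "(\<integral>w. f (X w) * \<eta>t (X w) \<partial>M) = (\<integral>w. f (X w) * indicator {w \<in> space M. Yt w = 1} w \<partial>M)"
    by (rule cond_prob_integral[OF X _ corrupted_regression _ f1, symmetric]) measurable
  also have "\<dots> = (\<integral>w. f (X w) * indicator ?Y1 w + s (X w, Y w) * indicator ?E w \<partial>M)"
  proof (rule Bochner_Integration.integral_cong[OF refl])
    fix w assume w: "w \<in> space M"
    show "f (X w) * indicator {w \<in> space M. Yt w = 1} w
        = f (X w) * indicator ?Y1 w + s (X w, Y w) * indicator ?E w"
      using w Y01[OF w] Yt01[OF w] by (auto simp: indicator_def s_def)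
  qed
  also have "\<dots> = (\<integral>w. f (X w) * indicator ?Y1 w \<partial>M) + (\<integral>w. s (X w, Y w) * indicator ?E w \<partial>M)"
    by (rule Bochner_Integration.integral_add[OF iY isE])
  also have "(\<integral>w. f (X w) * indicator ?Y1 w \<partial>M) = (\<integral>w. f (X w) * \<eta> (X w) \<partial>M)"
    by (rule cond_prob_integral[OF X _ regression _ f1]) measurable
  \<comment> \<open>Tower property: first condition on \<open>(X, Y)\<close>; the remaining
    dependence on \<open>Y\<close> is removed afterwards by conditioning on
    \<open>X\<close>.\<close>
  also have "(\<integral>w. s (X w, Y w) * indicator ?E w \<partial>M)
      = (\<integral>w. s (X w, Y w) * (\<lambda>(x, r). \<rho> r x) (X w, Y w) \<partial>M)"
    by (rule cond_prob_integral[OF _ _ noise _ s1]) measurable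
  also have "\<dots> = (\<integral>w. f (X w) * \<rho> 0 (X w) + d (X w) * indicator ?Y1 w \<partial>M)"
  proof (rule Bochner_Integration.integral_cong[OF refl])
    fix w assume w: "w \<in> space M"
    show "s (X w, Y w) * (\<lambda>(x, r). \<rho> r x) (X w, Y w)
        = f (X w) * \<rho> 0 (X w) + d (X w) * indicator ?Y1 w"
      using w Y01[OF w] by (auto simp: indicator_def s_def d_def algebra_simps)
  qed
  also have "\<dots> = (\<integral>w. f (X w) * \<rho> 0 (X w) \<partial>M) + (\<integral>w. d (X w) * indicator ?Y1 w \<partial>M)"
    by (rule Bochner_Integration.integral_add[OF ir idY])
  also have "(\<integral>w. d (X w) * indicator ?Y1 w \<partial>M) = (\<integral>w. d (X w) * \<eta> (X w) \<partial>M)"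
    by (rule cond_prob_integral[OF X _ regression _ d2]) measurable
  also have "(\<integral>w. f (X w) * \<eta> (X w) \<partial>M)
        + ((\<integral>w. f (X w) * \<rho> 0 (X w) \<partial>M) + (\<integral>w. d (X w) * \<eta> (X w) \<partial>M))
      = (\<integral>w. f (X w) * \<eta> (X w) + (f (X w) * \<rho> 0 (X w) + d (X w) * \<eta> (X w)) \<partial>M)"
    using if\<eta> ir id\<eta> by simp
  also have "\<dots> = (\<integral>w. f (X w) * h (X w) \<partial>M)"
    by (rule Bochner_Integration.integral_cong) (auto simp: d_def h_def algebra_simps)
  finally have "(\<integral>w. f (X w) * \<eta>t (X w) - f (X w) * h (X w) \<partial>M) = 0"
    using if\<eta>t ifh by simp
  moreover have sq: "f (X w) * \<eta>t (X w) - f (X w) * h (X w) = (f (X w))\<^sup>2" for w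
    by (simp add: f_def power2_eq_square algebra_simps)
  ultimately have "(\<integral>w. (f (X w))\<^sup>2 \<partial>M) = 0" by simp
  moreover have "integrable M (\<lambda>w. (f (X w))\<^sup>2)"
    using Bochner_Integration.integrable_diff[OF if\<eta>t ifh] by (simp add: sq)
  ultimately have "AE w in M. (f (X w))\<^sup>2 = 0"
    using integral_nonneg_eq_0_iff_AE[of M "\<lambda>w. (f (X w))\<^sup>2"] by simp
  then show ?thesis
    by eventually_elim (simp add: f_def h_def)
qed

section \<open>Margins and agreement of the two Bayes classifiers\<close>

text \<open>Expanding gives \<open>2 \<eta>t - 1 = (2 \<eta> - 1) (1 - \<rho> 0 - \<rho> 1) -
  (\<rho> 1 - \<rho> 0)\<close>. On \<open>setB\<close> the denominator of the noise ratio is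
  nonzero, so the last difference is ratio times denominator and the product factors out.\<close>

lemma margin_eq:
  assumes "\<eta>t x = \<eta> x * (1 - \<rho> 1 x) + (1 - \<eta> x) * \<rho> 0 x" and "x \<in> setB N \<eta> \<rho>"
  shows "2 * \<eta>t x - 1 = (2 * \<eta> x - 1) * ((1 - \<rho> 0 x - \<rho> 1 x) * (1 - noise_ratio \<eta> \<rho> x))"
proof -
  have "2 * \<eta> x - 1 \<noteq> 0" "1 - \<rho> 0 x - \<rho> 1 x \<noteq> 0"
    using assms(2) by (auto simp: setB_def setS_def)
  then have "(2 * \<eta> x - 1) * (1 - \<rho> 0 x - \<rho> 1 x) * noise_ratio \<eta> \<rho> x = \<rho> 1 x - \<rho> 0 x"
    by (simp add: noise_ratio_def)
  then have "(2 * \<eta> x - 1) * ((1 - \<rho> 0 x - \<rho> 1 x) * (1 - noise_ratio \<eta> \<rho> x))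
      = (2 * \<eta> x - 1) * (1 - \<rho> 0 x - \<rho> 1 x) - (\<rho> 1 x - \<rho> 0 x)"
    by (simp add: algebra_simps)
  then show ?thesis
    by (simp add: assms(1) algebra_simps)
qed

lemma margin_eq_AE:
  "AE x in distr M N X. x \<in> setB N \<eta> \<rho> \<longrightarrow>
     2 * \<eta>t x - 1 = (2 * \<eta> x - 1) * ((1 - \<rho> 0 x - \<rho> 1 x) * (1 - noise_ratio \<eta> \<rho> x))"
proof -
  have "AE x in distr M N X. \<eta>t x = \<eta> x * (1 - \<rho> 1 x) + (1 - \<eta> x) * \<rho> 0 x"
    using corrupted_regression_eq by (subst AE_distr_iff) measurable
  then show ?thesis
    by eventually_elim (intro impI margin_eq)
qed

text \<open>On \<open>setA\<close> the margin \<open>2 \<eta> - 1\<close> is multiplied by a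
  positive factor, which preserves its sign.\<close>

lemma bayes_eq_on_setA:
  assumes "x \<in> setA N \<eta> \<rho>"
    and "2 * \<eta>t x - 1 = (2 * \<eta> x - 1) * ((1 - \<rho> 0 x - \<rho> 1 x) * (1 - noise_ratio \<eta> \<rho> x))"
  shows "bayes \<eta>t x = bayes \<eta> x"
proof -
  have "0 < (1 - \<rho> 0 x - \<rho> 1 x) * (1 - noise_ratio \<eta> \<rho> x)"
    using assms(1) by (intro mult_pos_pos) (auto simp: setA_def setB_def)
  then have "0 \<le> 2 * \<eta>t x - 1 \<longleftrightarrow> 0 \<le> 2 * \<eta> x - 1"
    unfolding assms(2) by (metis zero_le_mult_iff less_le_not_le)
  then have "1 / 2 \<le> \<eta>t x \<longleftrightarrow> 1 / 2 \<le> \<eta> x" by linarith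
  then show ?thesis by (simp add: bayes_def)
qed

text \<open>Here the factor is at most 0, so the margins have weakly opposite signs. Since
  \<open>bayes\<close> sends ties to 1, a tie \<open>\<eta>t = 1/2\<close> still gives disagreement
  when \<open>\<eta> < 1/2\<close>; only ties with \<open>\<eta> > 1/2\<close> must be
  excluded.\<close>

lemma bayes_neq_off_setA:
  assumes "x \<in> setB N \<eta> \<rho> - setA N \<eta> \<rho>" and "\<not> (\<eta> x > 1 / 2 \<and> \<eta>t x = 1 / 2)"
    and eq: "2 * \<eta>t x - 1 = (2 * \<eta> x - 1) * ((1 - \<rho> 0 x - \<rho> 1 x) * (1 - noise_ratio \<eta> \<rho> x))"
  shows "bayes \<eta>t x \<noteq> bayes \<eta> x"
proof -
  have "(1 - \<rho> 0 x - \<rho> 1 x) * (1 - noise_ratio \<eta> \<rho> x) \<le> 0" and ne: "2 * \<eta> x - 1 \<noteq> 0"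
    using assms(1) by (auto simp: setA_def setB_def setS_def intro!: mult_nonneg_nonpos)
  then have "2 * \<eta> x - 1 > 0 \<Longrightarrow> 2 * \<eta>t x - 1 \<le> 0" "2 * \<eta> x - 1 < 0 \<Longrightarrow> 2 * \<eta>t x - 1 \<ge> 0"
    unfolding eq by (auto intro: mult_nonneg_nonpos mult_nonpos_nonpos)
  then show ?thesis
    using ne assms(2) by (cases "2 * \<eta> x - 1" "0 :: real" rule: linorder_cases) (auto simp: bayes_def)
qed

lemma measurable_sets_SBA [measurable]:
  "setS N \<eta> \<in> sets N" "setB N \<eta> \<rho> \<in> sets N" "setA N \<eta> \<rho> \<in> sets N"
  "noise_ratio \<eta> \<rho> \<in> borel_measurable N"
proof -
  show [measurable]: "noise_ratio \<eta> \<rho> \<in> borel_measurable N"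
    unfolding noise_ratio_def[abs_def] by measurable
  show [measurable]: "setS N \<eta> \<in> sets N" unfolding setS_def by measurable
  have "{x \<in> space N - setS N \<eta>. \<rho> 0 x + \<rho> 1 x < 1}
      = {x \<in> space N. x \<notin> setS N \<eta> \<and> \<rho> 0 x + \<rho> 1 x < 1}" by auto
  then show [measurable]: "setB N \<eta> \<rho> \<in> sets N" unfolding setB_def by simp
  have "{x \<in> setB N \<eta> \<rho>. noise_ratio \<eta> \<rho> x < 1}
      = {x \<in> space N. x \<in> setB N \<eta> \<rho> \<and> noise_ratio \<eta> \<rho> x < 1}" by (auto simp: setB_def)
  then show "setA N \<eta> \<rho> \<in> sets N" unfolding setA_def by simp
qed

text \<open>A converse to \<open>measure_eq_0_AE\<close>. Measurability of \<open>P\<close> matters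
  in this direction, since \<open>measure\<close> is 0 on non-measurable sets too.\<close>

lemma measure_distr_eq_0_AE:
  assumes "measure (distr M N X) {x \<in> space N. P x} = 0" and "Measurable.pred N P"
  shows "AE x in distr M N X. \<not> P x"
proof -
  interpret D: prob_space "distr M N X" by (rule prob_space_distr) measurable
  have "AE x in distr M N X. x \<notin> {x \<in> space N. P x}"
    using assms by (subst D.prob_eq_0[symmetric]) auto
  moreover have "AE x in distr M N X. x \<in> space N"
    by (rule AE_I2) simp
  ultimately show ?thesis by eventually_elim auto
qed

lemma bayes_agreement:
  assumes "measure (distr M N X) {x \<in> setB N \<eta> \<rho>. \<eta> x > 1 / 2 \<and> \<eta>t x = 1 / 2} = 0"
  shows "measure (distr M N X)
    (sym_diff (setA N \<eta> \<rho>) {x \<in> setB N \<eta> \<rho>. bayes \<eta>t x = bayes \<eta> x}) = 0"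
proof (rule measure_eq_0_AE)
  have "{x \<in> setB N \<eta> \<rho>. \<eta> x > 1 / 2 \<and> \<eta>t x = 1 / 2}
      = {x \<in> space N. x \<in> setB N \<eta> \<rho> \<and> \<eta> x > 1 / 2 \<and> \<eta>t x = 1 / 2}"
    by (auto simp: setB_def)
  then have "AE x in distr M N X. \<not> (x \<in> setB N \<eta> \<rho> \<and> \<eta> x > 1 / 2 \<and> \<eta>t x = 1 / 2)"
    using assms by (intro measure_distr_eq_0_AE) auto
  then show "AE x in distr M N X.
      x \<notin> sym_diff (setA N \<eta> \<rho>) {x \<in> setB N \<eta> \<rho>. bayes \<eta>t x = bayes \<eta> x}"
    using margin_eq_AE
  proof eventually_elim
    case (elim x)
    have "setA N \<eta> \<rho> \<subseteq> setB N \<eta> \<rho>" by (auto simp: setA_def)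
    then show ?case
      using elim bayes_eq_on_setA[of x] bayes_neq_off_setA[of x] by blast
  qed
qed

text \<open>Almost every point off \<open>setS\<close> lies in \<open>setA\<close>, so
  \<open>bayes_eq_on_setA\<close> settles the claim; up to a null set, the problematic ties lie
  outside \<open>setA\<close>.\<close>

lemma bayes_disagreement_null:
  assumes "measure (distr M N X) ((space N - setA N \<eta> \<rho>) \<inter> (space N - setS N \<eta>)) = 0"
  shows "measure (distr M N X) {x \<in> space N - setS N \<eta>. bayes \<eta>t x \<noteq> bayes \<eta> x} = 0"
proof (rule measure_eq_0_AE)
  have "(space N - setA N \<eta> \<rho>) \<inter> (space N - setS N \<eta>)
      = {x \<in> space N. x \<notin> setA N \<eta> \<rho> \<and> x \<notin> setS N \<eta>}" by auto
  then have "AE x in distr M N X. \<not> (x \<notin> setA N \<eta> \<rho> \<and> x \<notin> setS N \<eta>)"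
    using assms by (intro measure_distr_eq_0_AE) auto
  then show "AE x in distr M N X. x \<notin> {x \<in> space N - setS N \<eta>. bayes \<eta>t x \<noteq> bayes \<eta> x}"
    using margin_eq_AE
  proof eventually_elim
    case (elim x)
    have "setA N \<eta> \<rho> \<subseteq> setB N \<eta> \<rho>" by (auto simp: setA_def)
    then show ?case
      using elim bayes_eq_on_setA[of x] by blast
  qed
qed

section \<open>The excess risk bound\<close>

text \<open>This compares the integrands of the two excess risks, with \<open>c\<close> standing for
  \<open>C x\<close>. On \<open>setS\<close> the left side vanishes and the right side is
  nonnegative, whatever the corrupted classifier does there. Off \<open>setS\<close> the two Bayes
  classifiers agree, so only the margins need comparing.\<close>

lemma excess_pointwise:
  assumes x: "x \<in> space N" and c: "c = 0 \<or> c = 1"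
    and "\<rho>s < 1 / 2" "as < 1"
    and low: "x \<notin> setS N \<eta> \<Longrightarrow> \<rho> 0 x + \<rho> 1 x \<le> 2 * \<rho>s"
    and ratio: "x \<in> setB N \<eta> \<rho> \<Longrightarrow> noise_ratio \<eta> \<rho> x \<le> as"
    and eq: "x \<in> setB N \<eta> \<rho> \<Longrightarrow>
      2 * \<eta>t x - 1 = (2 * \<eta> x - 1) * ((1 - \<rho> 0 x - \<rho> 1 x) * (1 - noise_ratio \<eta> \<rho> x))"
  shows "(1 - 2 * \<rho>s) * (1 - as) * ((2 * \<eta> x - 1) * (real (bayes \<eta> x) - real c))
    \<le> (2 * \<eta>t x - 1) * (real (bayes \<eta>t x) - real c)"
proof (cases "x \<in> setS N \<eta>")
  case True
  have "0 \<le> (2 * \<eta>t x - 1) * (real (bayes \<eta>t x) - real c)"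
    using c by (auto simp: bayes_def)
  moreover have "2 * \<eta> x - 1 = 0" using True by (simp add: setS_def)
  ultimately show ?thesis by simp
next
  case False
  \<comment> \<open>Since \<open>2 * \<rho>s < 1\<close>, the bound \<open>low\<close> places
    \<open>x\<close> in \<open>setB\<close>; since \<open>as < 1\<close>, the bound
    \<open>ratio\<close> then places it in \<open>setA\<close>.\<close>
  then have B: "x \<in> setB N \<eta> \<rho>"
    using low x assms(3) by (auto simp: setB_def)
  then have A: "x \<in> setA N \<eta> \<rho>"
    using ratio assms(4) by (auto simp: setA_def)
  define k where "k = (1 - \<rho> 0 x - \<rho> 1 x) * (1 - noise_ratio \<eta> \<rho> x)"
  define e where "e = (2 * \<eta> x - 1) * (real (bayes \<eta> x) - real c)"
  \<comment> \<open>Both factors of \<open>k\<close> are bounded below separately, by the positive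
    numbers \<open>1 - 2 * \<rho>s\<close> and \<open>1 - as\<close>.\<close>
  have "(1 - 2 * \<rho>s) * (1 - as) \<le> k"
    unfolding k_def using low[OF False] ratio[OF B] assms(3,4) by (intro mult_mono) auto
  moreover have "0 \<le> e" using c by (auto simp: bayes_def e_def)
  ultimately have "(1 - 2 * \<rho>s) * (1 - as) * e \<le> k * e"
    by (rule mult_right_mono)
  then show ?thesis
    unfolding bayes_eq_on_setA[OF A eq[OF B]] eq[OF B] by (simp add: e_def k_def mult_ac)
qed

context
  fixes \<rho>s as :: real
  assumes \<rho>s: "\<rho>s < 1 / 2" and as: "as < 1"
    and low_noise: "measure (distr M N X) {x \<in> space N - setS N \<eta>. \<rho> 0 x + \<rho> 1 x > 2 * \<rho>s} = 0"
    and low_ratio: "measure (distr M N X) {x \<in> setB N \<eta> \<rho>. noise_ratio \<eta> \<rho> x > as} = 0"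
begin

text \<open>Integrate \<open>excess_pointwise\<close> over the law of \<open>X\<close>. The
  undivided form, linear in the risks, is the one averaged over training data later.\<close>

lemma excess_risk_bound_mult:
  assumes C: "C \<in> measurable N labels"
  shows "(1 - 2 * \<rho>s) * (1 - as) * (risk M X Y C - risk M X Y (bayes \<eta>))
    \<le> risk M X Yt C - risk M X Yt (bayes \<eta>t)"
proof -
  have "{x \<in> space N - setS N \<eta>. \<rho> 0 x + \<rho> 1 x > 2 * \<rho>s}
      = {x \<in> space N. x \<notin> setS N \<eta> \<and> \<rho> 0 x + \<rho> 1 x > 2 * \<rho>s}" by auto
  then have ae1: "AE x in distr M N X. \<not> (x \<notin> setS N \<eta> \<and> \<rho> 0 x + \<rho> 1 x > 2 * \<rho>s)"
    using low_noise by (intro measure_distr_eq_0_AE) auto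
  have "{x \<in> setB N \<eta> \<rho>. noise_ratio \<eta> \<rho> x > as}
      = {x \<in> space N. x \<in> setB N \<eta> \<rho> \<and> noise_ratio \<eta> \<rho> x > as}" by (auto simp: setB_def)
  then have ae2: "AE x in distr M N X. \<not> (x \<in> setB N \<eta> \<rho> \<and> noise_ratio \<eta> \<rho> x > as)"
    using low_ratio by (intro measure_distr_eq_0_AE) auto
  have "AE x in distr M N X. x \<in> space N"
    by (rule AE_I2) simp
  then have "AE x in distr M N X.
      (1 - 2 * \<rho>s) * (1 - as) * ((2 * \<eta> x - 1) * (real (bayes \<eta> x) - real (C x)))
      \<le> (2 * \<eta>t x - 1) * (real (bayes \<eta>t x) - real (C x))"
    using ae1 ae2 margin_eq_AE
  proof eventually_elim
    case (elim x)
    show ?case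
      using elim measurable_space[OF C, of x] \<rho>s as by (intro excess_pointwise) auto
  qed
  then have ae: "AE w in M.
      (1 - 2 * \<rho>s) * (1 - as) * ((2 * \<eta> (X w) - 1) * (real (bayes \<eta> (X w)) - real (C (X w))))
      \<le> (2 * \<eta>t (X w) - 1) * (real (bayes \<eta>t (X w)) - real (C (X w)))"
    by (rule AE_distrD[OF X])
  note e = excess_risk_integral[OF X Y regression C]
    and et = excess_risk_integral[OF X Yt corrupted_regression C]
  show ?thesis
    unfolding e(2) et(2) integral_mult_right_zero[symmetric]
    using ae e(1) et(1) by (intro integral_mono_AE) auto
qed

lemma excess_risk_bound:
  assumes "C \<in> measurable N labels"
  shows "risk M X Y C - risk M X Y (bayes \<eta>)
    \<le> (risk M X Yt C - risk M X Yt (bayes \<eta>t)) / ((1 - 2 * \<rho>s) * (1 - as))"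
  using excess_risk_bound_mult[OF assms] \<rho>s as by (simp add: pos_le_divide_eq mult.commute)

text \<open>For fixed data \<open>t\<close> the section of \<open>C\<close> is a classifier of
  \<open>X\<close> alone and obeys the bound. By independence, averaging its risks over the law of
  \<open>T\<close> gives the two risks of \<open>C\<close>.\<close>

lemma excess_risk_bound_training_data:
  assumes td: "training_data M N X Y Yt K T" and C [measurable]: "C \<in> measurable (N \<Otimes>\<^sub>M K) labels"
  shows "risk M (\<lambda>w. (X w, T w)) Y C - risk M X Y (bayes \<eta>)
    \<le> (risk M (\<lambda>w. (X w, T w)) Yt C - risk M X Yt (bayes \<eta>t)) / ((1 - 2 * \<rho>s) * (1 - as))"
proof -
  let ?Q = "N \<Otimes>\<^sub>M labels \<Otimes>\<^sub>M labels" and ?D = "distr M K T"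
  let ?k = "(1 - 2 * \<rho>s) * (1 - as)"
  have T [measurable]: "T \<in> measurable M K"
    and indep: "indep_set (sets (vimage_algebra (space M) T K))
      (sets (vimage_algebra (space M) (\<lambda>w. (X w, Y w, Yt w)) ?Q))"
    using td by (auto simp: training_data_def)
  interpret D: prob_space ?D by (rule prob_space_distr) fact
  have "(\<lambda>z. C (fst (snd z), fst z)) \<in> measurable (K \<Otimes>\<^sub>M ?Q) (count_space UNIV)"
      "(\<lambda>z. fst (snd (snd z))) \<in> measurable (K \<Otimes>\<^sub>M ?Q) (count_space UNIV)"
      "(\<lambda>z. snd (snd (snd z))) \<in> measurable (K \<Otimes>\<^sub>M ?Q) (count_space UNIV)"
    by (auto intro!: measurable_labels_UNIV measurable_compose[OF _ C])
  note m = this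
  have Z: "(\<lambda>w. (X w, Y w, Yt w)) \<in> measurable M ?Q" by measurable
  \<comment> \<open>The error events as predicates on data and triple, in the order
    \<open>(T, Z)\<close> of \<open>indep_prob_integral\<close>; \<open>C\<close> itself takes the
    data second.\<close>
  have "Measurable.pred (K \<Otimes>\<^sub>M ?Q) (\<lambda>(t, x, y, yt). C (x, t) \<noteq> y)"
    "Measurable.pred (K \<Otimes>\<^sub>M ?Q) (\<lambda>(t, x, y, yt). C (x, t) \<noteq> yt)"
    unfolding split_beta by (rule measurable_neq_nat; fact m)+
  note R = this[THEN indep_prob_integral(1)[OF T Z indep]]
    this[THEN indep_prob_integral(2)[OF T Z indep]]
  let ?c = "\<lambda>t x. C (x, t)"
  have int: "integrable ?D (\<lambda>t. risk M X Y (?c t))" "integrable ?D (\<lambda>t. risk M X Yt (?c t))"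
    and eq: "risk M (\<lambda>w. (X w, T w)) Y C = (\<integral>t. risk M X Y (?c t) \<partial>?D)"
      "risk M (\<lambda>w. (X w, T w)) Yt C = (\<integral>t. risk M X Yt (?c t) \<partial>?D)"
    using R by (simp_all add: risk_def)
  have "(\<integral>t. ?k * (risk M X Y (?c t) - risk M X Y (bayes \<eta>)) \<partial>?D)
      \<le> (\<integral>t. risk M X Yt (?c t) - risk M X Yt (bayes \<eta>t) \<partial>?D)"
  proof (rule integral_mono)
    fix t assume "t \<in> space ?D"
    then have "?c t \<in> measurable N labels"
      by (intro measurable_compose[OF _ C]) simp
    then show "?k * (risk M X Y (?c t) - risk M X Y (bayes \<eta>))
        \<le> risk M X Yt (?c t) - risk M X Yt (bayes \<eta>t)"
      by (rule excess_risk_bound_mult)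
  qed (use int in auto)
  \<comment> \<open>The Bayes risks do not depend on \<open>t\<close> and integrate to themselves
    because the law of \<open>T\<close> has total mass 1.\<close>
  then have "?k * (risk M (\<lambda>w. (X w, T w)) Y C - risk M X Y (bayes \<eta>))
      \<le> risk M (\<lambda>w. (X w, T w)) Yt C - risk M X Yt (bayes \<eta>t)"
    using int by (simp add: eq D.prob_space[unfolded space_distr])
  then show ?thesis
    using \<rho>s as by (simp add: pos_le_divide_eq mult.commute)
qed

end

end

theorem theorem1:
  fixes M :: "'w measure" and N :: "'x measure" and K :: "'t measure"
    and X :: "'w \<Rightarrow> 'x" and Y Yt :: "'w \<Rightarrow> nat" and T :: "'w \<Rightarrow> 't"
    and \<eta> \<eta>t :: "'x \<Rightarrow> real" and \<rho> :: "nat \<Rightarrow> 'x \<Rightarrow> real"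
  assumes "label_noise M N X Y Yt \<eta> \<rho> \<eta>t"
  defines "PX \<equiv> measure (distr M N X)"
    and "S \<equiv> setS N \<eta>" and "B \<equiv> setB N \<eta> \<rho>" and "A \<equiv> setA N \<eta> \<rho>"
  shows
    \<comment> \<open>A point of \<open>B\<close> with \<open>\<eta> > 1/2\<close> and \<open>\<eta>t = 1/2\<close> has noise ratio 1, so it is outside
      \<open>A\<close>, but both classifiers take the value 1 there: if such points carry mass, the
      symmetric difference has positive probability.\<close>
    "(PX {x \<in> B. \<eta> x > 1 / 2 \<and> \<eta>t x = 1 / 2} = 0 \<longrightarrow>
        PX (sym_diff A {x \<in> B. bayes \<eta>t x = bayes \<eta> x}) = 0)
     \<and> (PX ((space N - A) \<inter> (space N - S)) = 0 \<longrightarrow>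
          PX {x \<in> space N - S. bayes \<eta>t x \<noteq> bayes \<eta> x} = 0)
     \<and> (\<forall>\<rho>s as :: real.
          \<rho>s < 1 / 2 \<and> as < 1 \<and>
          PX {x \<in> space N - S. \<rho> 0 x + \<rho> 1 x > 2 * \<rho>s} = 0 \<and>
          PX {x \<in> B. noise_ratio \<eta> \<rho> x > as} = 0 \<longrightarrow>
            (\<forall>C \<in> measurable N labels.
               risk M X Y C - risk M X Y (bayes \<eta>)
                 \<le> (risk M X Yt C - risk M X Yt (bayes \<eta>t)) / ((1 - 2 * \<rho>s) * (1 - as)))
          \<and> (training_data M N X Y Yt K T \<longrightarrow>
             (\<forall>C \<in> measurable (N \<Otimes>\<^sub>M K) labels.
               risk M (\<lambda>w. (X w, T w)) Y C - risk M X Y (bayes \<eta>)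
                 \<le> (risk M (\<lambda>w. (X w, T w)) Yt C - risk M X Yt (bayes \<eta>t))
                     / ((1 - 2 * \<rho>s) * (1 - as)))))"
proof -
  interpret label_noise M N X Y Yt \<eta> \<rho> \<eta>t by fact
  show ?thesis
    unfolding PX_def S_def B_def A_def
    by (intro conjI allI impI ballI; (elim conjE)?)
      (rule bayes_agreement bayes_disagreement_null excess_risk_bound
        excess_risk_bound_training_data; assumption)+
qed

end
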